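(* Let $A>0$ be fixed. (Charlier) Let $\mu>0$ and, for $n\ge1$, let $$D_n=\frac{A\,\mu^n}{n!\,\bigl(1+A\,K^{C}_{n-1}\bigr)},\qquad K^{C}_{n-1}=\sum_{m=0}^{n-1}\frac{\mu^m}{m!}.$$ Then, as $n\to\infty$, $$D_n=\frac{A}{1+A\,e^{\mu}}\,\frac{\mu^n}{n!}\,\bigl(1+O(\mu^n/n!)\bigr).$$ (Meixner) Let $\gamma>0$, $0<\mu<1$ and, for $n\ge1$, let $$B_n=\frac{A\,\mu^n(1-\mu)^{\gamma-1}(\gamma)_n}{n!\,\bigl(1+A\,K^{M}_{n-1}\bigr)},\qquad K^{M}_{n-1}=(1-\mu)^{\gamma}\sum_{m=0}^{n-1}\frac{(\gamma)_m\,\mu^m}{m!}.$$ Then, as $n\to\infty$, $$B_n=\frac{A\,(1-\mu)^{\gamma-1}}{(1+A)\,\Gamma(\gamma)}\,\mu^n\,n^{\gamma-1}\,\bigl(1+O(n^{-1})\bigr).$$ In particular, $D_n\to0$ and $B_n\to0$ faster than any power of $n^{-1}$ (that is, $n^{s}D_n\to0$ and $n^{s}B_n\to0$ for every $s\ge0$), and $nD_n\to0$, $nB_n\to0$.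
   Context: $(\gamma)_m=\Gamma(\gamma+m)/\Gamma(\gamma)$ is the Pochhammer symbol (rising factorial). The $O$-terms are as $n\to\infty$ with all parameters ($A$, $\mu$, and in the Meixner case $\gamma$) fixed. The quantities $K^{C}_{n-1}$ and $K^{M}_{n-1}$ are the values at $(0,0)$ of the reproducing kernels $\sum_{m=0}^{n-1}P_m(x)P_m(y)/d_m^2$ of the monic Charlier and Meixner polynomials, and $D_n$, $B_n$ are the coefficients in the connection formulas $P_n^A=P_n+D_n\nabla P_n$ (Charlier), $P_n^A=P_n+B_n\nabla P_n$ (Meixner) for the polynomials orthogonal after adding the mass $A\delta_0$ to the orthogonality measure, where $\nabla f(x)=f(x)-f(x-1)$. *)

theory Defs
  imports "HOL-Analysis.Analysis" "HOL-Library.Landau_Symbols"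
begin

text \<open>
  The subtraction \<open>n - 1\<close> below is truncated, so the values of \<open>charlier_D\<close> and \<open>meixner_B\<close>
  are meaningful for \<open>n \<ge> 1\<close> only. For \<open>\<gamma> > 0\<close>, \<open>pochhammer \<gamma> m\<close> is
  \<open>Gamma (\<gamma> + m) / Gamma \<gamma>\<close>, by \<open>pochhammer_Gamma\<close>.
\<close>

definition charlier_K :: "real \<Rightarrow> nat \<Rightarrow> real" where
  "charlier_K \<mu> n = (\<Sum>m=0..n. \<mu> ^ m / fact m)"

definition charlier_D :: "real \<Rightarrow> real \<Rightarrow> nat \<Rightarrow> real" where
  "charlier_D A \<mu> n = A * \<mu> ^ n / (fact n * (1 + A * charlier_K \<mu> (n - 1)))"

definition meixner_K :: "real \<Rightarrow> real \<Rightarrow> nat \<Rightarrow> real" where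
  "meixner_K \<gamma> \<mu> n =
     (1 - \<mu>) powr \<gamma> * (\<Sum>m=0..n. pochhammer \<gamma> m * \<mu> ^ m / fact m)"

definition meixner_B :: "real \<Rightarrow> real \<Rightarrow> real \<Rightarrow> nat \<Rightarrow> real" where
  "meixner_B A \<gamma> \<mu> n =
     A * \<mu> ^ n * (1 - \<mu>) powr (\<gamma> - 1) * pochhammer \<gamma> n
       / (fact n * (1 + A * meixner_K \<gamma> \<mu> (n - 1)))"

end

theory Submission
  imports Defs "HOL-Real_Asymp.Real_Asymp"
begin

text \<open>
  Both coefficients have the shape \<open>A * w n / (1 + A * K n)\<close>, where \<open>K n\<close> is a partial sum of a
  convergent series of positive terms: the exponential series with sum \<open>exp \<mu>\<close> in the Charlier
  case, the binomial series in the Meixner case, where the factor \<open>(1 - \<mu>) powr \<gamma>\<close> normalises the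
  sum to \<open>1\<close>. Replacing \<open>K n\<close> by its limit \<open>L\<close> costs exactly the relative error
  \<open>A * (L - K n) / (1 + A * K n)\<close>, which is at most \<open>A\<close> times the tail of the series.

  For Charlier, \<open>(m + n)! \<ge> m! * n!\<close> bounds the tail by \<open>exp \<mu> * (\<mu> ^ n / n!)\<close>, the
  claimed order. For Meixner, the series still converges at every point of \<open>{\<mu><..<1}\<close>, so the tail
  decays geometrically and its contribution is far below \<open>1 / n\<close>
  (\<open>nonneg_powser_tail_le\<close>). The error \<open>1 / n\<close> comes from the other ingredient,
  \<open>pochhammer \<gamma> n / n! = n powr (\<gamma> - 1) / Gamma \<gamma> * (1 + O(1 / n))\<close>
  (\<open>pochhammer_over_fact_asymp\<close>): the quotient of the two sides tends to \<open>1\<close> by Euler's product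
  for \<open>Gamma\<close>, and its increments are \<open>O(1 / n\<^sup>2)\<close>, which sums to \<open>O(1 / n)\<close>.

  The same geometric bound on the terms of the two series shows that \<open>D\<close> and \<open>B\<close> are
  \<open>O(q ^ n)\<close> for some \<open>q < 1\<close>, which beats every power of \<open>n\<close>.
\<close>

section \<open>Rates of convergence\<close>

text \<open>
  Summing the bound on the increments from \<open>n\<close> to infinity telescopes to \<open>b n\<close>. In terms of
  monotone sequences: from \<open>n\<close> on \<open>a + b\<close> decreases and \<open>a - b\<close> increases, and both tend to \<open>L\<close>.
\<close>

lemma dist_limit_le_majorant:
  fixes a b :: "nat \<Rightarrow> real"
  assumes a: "a \<longlonglongrightarrow> L" and b: "b \<longlonglongrightarrow> 0"
    and step: "\<And>k. k \<ge> n \<Longrightarrow> \<bar>a (Suc k) - a k\<bar> \<le> b k - b (Suc k)"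
  shows "\<bar>a n - L\<bar> \<le> b n"
proof -
  have "decseq (\<lambda>k. a (k + n) + b (k + n))"
  proof (rule decseq_SucI)
    show "a (Suc k + n) + b (Suc k + n) \<le> a (k + n) + b (k + n)" for k
      using step[of "k + n"] by simp
  qed
  moreover have "(\<lambda>k. a (k + n) + b (k + n)) \<longlonglongrightarrow> L + 0"
    by (intro tendsto_add LIMSEQ_ignore_initial_segment a b)
  ultimately have 1: "L + 0 \<le> a (0 + n) + b (0 + n)"
    by (rule decseq_ge)
  have "incseq (\<lambda>k. a (k + n) - b (k + n))"
  proof (rule incseq_SucI)
    show "a (Suc k + n) - b (Suc k + n) \<ge> a (k + n) - b (k + n)" for k
      using step[of "k + n"] by simp
  qed
  moreover have "(\<lambda>k. a (k + n) - b (k + n)) \<longlonglongrightarrow> L - 0"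
    by (intro tendsto_diff LIMSEQ_ignore_initial_segment a b)
  ultimately have 2: "a (0 + n) - b (0 + n) \<le> L - 0"
    by (rule incseq_le)
  from 1 2 show ?thesis by simp
qed

lemma dist_limit_bigo_majorant:
  fixes a b :: "nat \<Rightarrow> real"
  assumes a: "a \<longlonglongrightarrow> L" and b: "b \<longlonglongrightarrow> 0"
    and mono: "\<forall>\<^sub>F n in sequentially. b (Suc n) \<le> b n"
    and step: "(\<lambda>n. a (Suc n) - a n) \<in> O(\<lambda>n. b n - b (Suc n))"
  shows "(\<lambda>n. a n - L) \<in> O(b)"
proof -
  obtain C where "C > 0"
    and "\<forall>\<^sub>F n in sequentially. norm (a (Suc n) - a n) \<le> C * norm (b n - b (Suc n))"
    using landau_o.bigE[OF step] by blast
  from this(2) mono have "\<forall>\<^sub>F n in sequentially. \<bar>a (Suc n) - a n\<bar> \<le> C * b n - C * b (Suc n)"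
    by (rule eventually_elim2) (simp add: algebra_simps)
  then obtain N where N: "\<And>n. n \<ge> N \<Longrightarrow> \<bar>a (Suc n) - a n\<bar> \<le> C * b n - C * b (Suc n)"
    unfolding eventually_sequentially by blast
  have "\<bar>a n - L\<bar> \<le> C * b n" if "n \<ge> N" for n
  proof (rule dist_limit_le_majorant[OF a])
    show "(\<lambda>n. C * b n) \<longlonglongrightarrow> 0" using tendsto_mult_left[OF b, of C] by simp
  qed (use N that in auto)
  moreover have "C * b n \<le> C * \<bar>b n\<bar>" for n
    using \<open>C > 0\<close> by simp
  ultimately have "\<bar>a n - L\<bar> \<le> C * \<bar>b n\<bar>" if "n \<ge> N" for n
    using that order_trans by blast
  then show ?thesis
    by (intro bigoI[of _ C] eventually_sequentiallyI[of N]) simp_all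
qed

lemma bigo_tendsto_zero:
  fixes f g :: "nat \<Rightarrow> real"
  assumes f: "f \<in> O(g)" and g: "g \<longlonglongrightarrow> 0"
  shows "f \<longlonglongrightarrow> 0"
proof -
  obtain C where "\<forall>\<^sub>F n in sequentially. norm (f n) \<le> C * norm (g n)"
    using landau_o.bigE[OF f] by blast
  then have "\<forall>\<^sub>F n in sequentially. norm (f n) \<le> norm (g n) * C"
    by (simp add: mult.commute)
  then show ?thesis by (rule tendsto_0_le[OF g])
qed

lemma geometric_imp_rapid_decay:
  fixes d :: "nat \<Rightarrow> real"
  assumes d: "d \<in> O(\<lambda>n. q ^ n)" and q: "0 < q" "q < 1"
  shows "(\<lambda>n. real n powr s * d n) \<longlonglongrightarrow> 0" "d \<longlonglongrightarrow> 0" "(\<lambda>n. real n * d n) \<longlonglongrightarrow> 0"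
proof -
  have "(\<lambda>n. real n powr s * d n) \<in> O(\<lambda>n. real n powr s * q ^ n)"
    by (intro landau_o.big.mult_left d)
  moreover have "(\<lambda>n::nat. real n powr s * q ^ n) \<longlonglongrightarrow> 0"
    using q by real_asymp
  ultimately show "(\<lambda>n. real n powr s * d n) \<longlonglongrightarrow> 0"
    by (rule bigo_tendsto_zero)
  show "d \<longlonglongrightarrow> 0"
    by (rule bigo_tendsto_zero[OF d]) (use q in real_asymp)
  have "(\<lambda>n. real n * d n) \<in> O(\<lambda>n. real n * q ^ n)"
    by (intro landau_o.big.mult_left d)
  moreover have "(\<lambda>n::nat. real n * q ^ n) \<longlonglongrightarrow> 0"
    using q by real_asymp
  ultimately show "(\<lambda>n. real n * d n) \<longlonglongrightarrow> 0"
    by (rule bigo_tendsto_zero)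
qed

section \<open>Power series with nonnegative coefficients\<close>

text \<open>
  Factoring \<open>x ^ m = (x / y) ^ m * y ^ m\<close> and bounding \<open>(x / y) ^ m\<close> by \<open>(x / y) ^ n\<close> for
  \<open>m \<ge> n\<close> leaves a part of the convergent series at \<open>y\<close>.
\<close>

lemma nonneg_powser_tail_le:
  fixes c :: "nat \<Rightarrow> real"
  assumes c: "\<And>n. c n \<ge> 0" and sm: "summable (\<lambda>n. c n * y ^ n)" and xy: "0 \<le> x" "x < y"
  shows "summable (\<lambda>n. c n * x ^ n)"
    and "(\<Sum>m. c (m + n) * x ^ (m + n)) \<le> (x / y) ^ n * (\<Sum>m. c m * y ^ m)"
    and "c n * x ^ n \<le> (x / y) ^ n * (\<Sum>m. c m * y ^ m)"
proof -
  have y: "y > 0" using xy by simp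
  have nn: "0 \<le> c m * y ^ m" "0 \<le> c m * x ^ m" for m
    using c xy by auto
  have le: "c (m + n) * x ^ (m + n) \<le> (x / y) ^ n * (c (m + n) * y ^ (m + n))" for m n
  proof -
    have "(x / y) ^ (m + n) \<le> (x / y) ^ n"
      using xy y by (intro power_decreasing) auto
    moreover have "x ^ (m + n) = (x / y) ^ (m + n) * y ^ (m + n)"
      using y by (simp add: power_divide)
    ultimately show ?thesis
      using mult_right_mono[OF _ nn(1)[of "m + n"], of "(x / y) ^ (m + n)" "(x / y) ^ n"]
      by (simp add: mult_ac)
  qed
  have smn: "summable (\<lambda>m. c (m + n) * y ^ (m + n))" for n
    using sm summable_iff_shift[of "\<lambda>m. c m * y ^ m" n] by blast
  show smx: "summable (\<lambda>n. c n * x ^ n)"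
    using le[of _ 0] nn by (intro summable_comparison_test[OF _ sm]) auto
  then have smxn: "summable (\<lambda>m. c (m + n) * x ^ (m + n))"
    using summable_iff_shift[of "\<lambda>m. c m * x ^ m" n] by blast
  have "(\<Sum>m. c (m + n) * x ^ (m + n)) \<le> (x / y) ^ n * (\<Sum>m. c (m + n) * y ^ (m + n))"
    using le by (subst suminf_mult[OF smn, symmetric])
                (intro suminf_le smxn summable_mult smn; simp)
  also have "\<dots> \<le> (x / y) ^ n * (\<Sum>m. c m * y ^ m)"
    using suminf_split_initial_segment[OF sm, of n] nn xy y
    by (intro mult_left_mono) (auto intro: sum_nonneg)
  finally show tail: "(\<Sum>m. c (m + n) * x ^ (m + n)) \<le> (x / y) ^ n * (\<Sum>m. c m * y ^ m)" .
  have "c n * x ^ n = (\<Sum>m\<in>{0}. c (m + n) * x ^ (m + n))" by simp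
  also have "\<dots> \<le> (\<Sum>m. c (m + n) * x ^ (m + n))"
    using nn by (intro sum_le_suminf smxn) auto
  also note tail
  finally show "c n * x ^ n \<le> (x / y) ^ n * (\<Sum>m. c m * y ^ m)" .
qed

text \<open>
  In the application \<open>k\<close> is a partial sum and \<open>L\<close> the sum of the series, so that the relative
  error is controlled by the tail \<open>L - k\<close>.
\<close>

lemma mass_denominator_error:
  fixes A k L :: real
  assumes "A > 0" "0 \<le> k" "k \<le> L"
  shows "1 / (1 + A * k) = 1 / (1 + A * L) * (1 + A * (L - k) / (1 + A * k))"
    and "\<bar>A * (L - k) / (1 + A * k)\<bar> \<le> A * (L - k)"
proof -
  have pos: "1 + A * k > 0" "1 + A * L > 0"
    using assms by (auto intro!: add_pos_nonneg)
  then show "1 / (1 + A * k) = 1 / (1 + A * L) * (1 + A * (L - k) / (1 + A * k))"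
    by (simp add: divide_simps) (simp add: algebra_simps)
  have "A * (L - k) / (1 + A * k) \<le> A * (L - k) / 1"
    using assms pos by (intro divide_left_mono) auto
  then show "\<bar>A * (L - k) / (1 + A * k)\<bar> \<le> A * (L - k)"
    using assms pos by simp
qed

section \<open>Charlier coefficients\<close>

lemma charlier_K_pred:
  assumes "n \<ge> 1"
  shows "charlier_K \<mu> (n - 1) = (\<Sum>m<n. \<mu> ^ m / fact m)"
  using assms by (cases n) (simp_all add: charlier_K_def atLeast0AtMost lessThan_Suc_atMost)

lemma charlier_K_nonneg: "\<mu> > 0 \<Longrightarrow> charlier_K \<mu> n \<ge> 0"
  unfolding charlier_K_def by (intro sum_nonneg) auto

text \<open>
  Since \<open>m! * n! \<le> (m + n)!\<close>, the term of index \<open>m + n\<close> is at most the product of the terms of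
  indices \<open>m\<close> and \<open>n\<close>; summing over \<open>m\<close> gives \<open>exp x\<close> times the \<open>n\<close>-th term.
\<close>

lemma exp_series_tail_le:
  fixes x :: real
  assumes "x > 0"
  shows "0 \<le> exp x - (\<Sum>m<n. x ^ m / fact m)"
    and "exp x - (\<Sum>m<n. x ^ m / fact m) \<le> exp x * (x ^ n / fact n)"
proof -
  define f where "f = (\<lambda>m. x ^ m / fact m)"
  have f: "f sums exp x"
    using exp_converges[of x] by (simp add: f_def divide_inverse_commute)
  then have sm: "summable f" and sum: "suminf f = exp x"
    by (auto simp: sums_iff)
  have nn: "f m \<ge> 0" for m
    using assms by (simp add: f_def)
  have smn: "summable (\<lambda>m. f (m + n))"
    using sm summable_iff_shift[of f n] by blast
  have eq: "exp x - (\<Sum>m<n. x ^ m / fact m) = (\<Sum>m. f (m + n))"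
    using suminf_split_initial_segment[OF sm, of n] sum by (simp add: f_def)
  show "0 \<le> exp x - (\<Sum>m<n. x ^ m / fact m)"
    unfolding eq by (intro suminf_nonneg smn nn)
  have "f (m + n) \<le> f m * f n" for m
  proof -
    have "fact m * fact n \<le> (fact (m + n) :: nat)"
      using fact_fact_dvd_fact[of m n, where ?'a = nat] by (intro dvd_imp_le) auto
    then have "fact m * fact n \<le> (fact (m + n) :: real)"
      by (metis of_nat_fact of_nat_le_iff of_nat_mult)
    then have "x ^ (m + n) / fact (m + n) \<le> x ^ (m + n) / (fact m * fact n)"
      using assms by (intro divide_left_mono) auto
    then show ?thesis by (simp add: f_def power_add)
  qed
  then have "(\<Sum>m. f (m + n)) \<le> (\<Sum>m. f m * f n)"
    by (intro suminf_le smn summable_mult2 sm)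
  also have "\<dots> = exp x * (x ^ n / fact n)"
    using suminf_mult2[OF sm, of "f n"] sum by (simp add: f_def)
  finally show "exp x - (\<Sum>m<n. x ^ m / fact m) \<le> exp x * (x ^ n / fact n)"
    unfolding eq .
qed

lemma charlier_D_asymp:
  fixes A \<mu> :: real
  assumes A: "A > 0" and \<mu>: "\<mu> > 0"
  shows "\<exists>\<epsilon> :: nat \<Rightarrow> real. \<epsilon> \<in> O(\<lambda>n. \<mu> ^ n / fact n) \<and>
           (\<forall>n\<ge>1. charlier_D A \<mu> n =
              A / (1 + A * exp \<mu>) * (\<mu> ^ n / fact n) * (1 + \<epsilon> n))"
proof -
  define \<epsilon> where "\<epsilon> = (\<lambda>n. let k = charlier_K \<mu> (n - 1) in A * (exp \<mu> - k) / (1 + A * k))"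
  have K: "0 \<le> charlier_K \<mu> (n - 1)" "charlier_K \<mu> (n - 1) \<le> exp \<mu>"
    "exp \<mu> - charlier_K \<mu> (n - 1) \<le> exp \<mu> * (\<mu> ^ n / fact n)" if "n \<ge> 1" for n
    using exp_series_tail_le[OF \<mu>, of n] charlier_K_nonneg[OF \<mu>, of "n - 1"]
    unfolding charlier_K_pred[OF that] by simp_all
  have "\<bar>\<epsilon> n\<bar> \<le> A * exp \<mu> * \<bar>\<mu> ^ n / fact n\<bar>" if "n \<ge> 1" for n
    using mass_denominator_error(2)[OF A K(1,2)[OF that]] mult_left_mono[OF K(3)[OF that], of A] A \<mu>
    by (simp add: \<epsilon>_def Let_def)
  then have "\<epsilon> \<in> O(\<lambda>n. \<mu> ^ n / fact n)"
    by (intro bigoI[of _ "A * exp \<mu>"] eventually_sequentiallyI[of 1]) auto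
  moreover have "charlier_D A \<mu> n = A / (1 + A * exp \<mu>) * (\<mu> ^ n / fact n) * (1 + \<epsilon> n)"
    if "n \<ge> 1" for n
  proof -
    have "charlier_D A \<mu> n = A * (\<mu> ^ n / fact n) * (1 / (1 + A * charlier_K \<mu> (n - 1)))"
      by (simp add: charlier_D_def)
    also note mass_denominator_error(1)[OF A K(1,2)[OF that]]
    finally show ?thesis by (simp add: \<epsilon>_def Let_def)
  qed
  ultimately show ?thesis by blast
qed

text \<open>
  The exponential series converges everywhere; comparing with its value at \<open>2 * \<mu>\<close> already gives
  \<open>\<mu> ^ n / n! = O((1 / 2) ^ n)\<close>.
\<close>

lemma charlier_D_geometric:
  fixes A \<mu> :: real
  assumes A: "A > 0" and \<mu>: "\<mu> > 0"
  shows "charlier_D A \<mu> \<in> O(\<lambda>n. (1 / 2) ^ n)"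
proof -
  have sm: "summable (\<lambda>n. inverse (fact n) * (2 * \<mu>) ^ n)"
    by (rule summable_exp)
  define S where "S = (\<Sum>n. inverse (fact n) * (2 * \<mu>) ^ n)"
  have le: "\<mu> ^ n / fact n \<le> (1 / 2) ^ n * S" for n
    using nonneg_powser_tail_le(3)[OF _ sm, of \<mu> n] \<mu> by (simp add: S_def field_simps)
  have "norm (charlier_D A \<mu> n) \<le> A * S * norm ((1 / 2) ^ n :: real)" for n
  proof -
    have K: "charlier_K \<mu> (n - 1) \<ge> 0" by (rule charlier_K_nonneg[OF \<mu>])
    then have "norm (charlier_D A \<mu> n) = A * \<mu> ^ n / fact n / (1 + A * charlier_K \<mu> (n - 1))"
      using A \<mu> by (simp add: charlier_D_def)
    also have "\<dots> \<le> A * \<mu> ^ n / fact n / 1"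
      using A \<mu> K by (intro divide_left_mono) (auto intro: add_pos_nonneg)
    also have "\<dots> \<le> A * ((1 / 2) ^ n * S)"
      using mult_left_mono[OF le[of n], of A] A by simp
    finally show ?thesis by (simp add: mult_ac)
  qed
  then show ?thesis by (intro bigoI[of _ "A * S"] always_eventually allI)
qed

section \<open>Growth of the Pochhammer symbol\<close>

text \<open>
  Consecutive quotients \<open>w (n + 1) / w n = (\<gamma> + n) / (n + 1) * (n / (n + 1)) powr (\<gamma> - 1)\<close> are
  \<open>1 + O(1 / n\<^sup>2)\<close>, since the first-order terms \<open>(\<gamma> - 1) / n\<close> and \<open>- (\<gamma> - 1) / n\<close> cancel. The
  increments of \<open>w\<close> are thus at most of the order of those of \<open>1 / n\<close>.
\<close>

lemma pochhammer_over_fact_asymp: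
  fixes \<gamma> :: real
  assumes \<gamma>: "\<gamma> > 0"
  defines "w \<equiv> \<lambda>n. Gamma \<gamma> * pochhammer \<gamma> n / (fact n * real n powr (\<gamma> - 1))"
  shows "(\<lambda>n. w n - 1) \<in> O(\<lambda>n. 1 / real n)"
proof (rule dist_limit_bigo_majorant)
  \<comment> \<open>Euler's approximants to \<open>1 / Gamma \<gamma>\<close> contain \<open>pochhammer \<gamma> (n + 1)\<close> and \<open>n powr \<gamma>\<close>, hence the
    correction \<open>n / (\<gamma> + n)\<close>.\<close>
  have "w n = Gamma \<gamma> * rGamma_series \<gamma> n * (real n / (\<gamma> + real n))" if "n \<ge> 1" for n
    using that \<gamma>
    by (simp add: w_def rGamma_series_def pochhammer_Suc powr_def exp_diff left_diff_distrib)
  then have "\<forall>\<^sub>F n in sequentially. Gamma \<gamma> * rGamma_series \<gamma> n * (real n / (\<gamma> + real n)) = w n"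
    by (intro eventually_sequentiallyI[of 1]) simp
  moreover have "(\<lambda>n. Gamma \<gamma> * rGamma_series \<gamma> n * (real n / (\<gamma> + real n)))
      \<longlonglongrightarrow> Gamma \<gamma> * rGamma \<gamma> * 1"
    by (intro tendsto_mult tendsto_const rGamma_series_LIMSEQ) real_asymp
  moreover have "Gamma \<gamma> * rGamma \<gamma> * 1 = 1"
    using Gamma_real_pos[OF \<gamma>] by (simp add: rGamma_inverse_Gamma)
  ultimately show w: "w \<longlonglongrightarrow> 1"
    using Lim_transform_eventually by metis
  define g where
    "g = (\<lambda>n::nat. (\<gamma> + real n) / (real n + 1) * (real n / (real n + 1)) powr (\<gamma> - 1) - 1)"
  have "w (Suc n) - w n = w n * g n" if "n \<ge> 1" for n
  proof -
    have "w (Suc n) = w n * ((\<gamma> + real n) / (real n + 1) * (real n / (real n + 1)) powr (\<gamma> - 1))"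
      using that by (simp add: w_def pochhammer_Suc powr_divide divide_simps) (simp add: mult_ac add_ac)
    then show ?thesis by (simp add: g_def algebra_simps)
  qed
  then have "\<forall>\<^sub>F n in sequentially. w (Suc n) - w n = w n * g n"
    by (intro eventually_sequentiallyI[of 1]) simp
  moreover have "(\<lambda>n. w n * g n) \<in> O(\<lambda>n. 1 * (1 / real n ^ 2))"
  proof (rule landau_o.big.mult)
    show "w \<in> O(\<lambda>_. 1)" using w by (intro bigoI_tendsto[of _ _ 1]) auto
    show "g \<in> O(\<lambda>n. 1 / real n ^ 2)" unfolding g_def by real_asymp
  qed
  ultimately have "(\<lambda>n. w (Suc n) - w n) \<in> O(\<lambda>n. 1 / real n ^ 2)"
    by (simp add: landau_o.big.in_cong)
  also have "(\<lambda>n. 1 / real n ^ 2) \<in> O(\<lambda>n. 1 / real n - 1 / real (Suc n))"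
    by real_asymp
  finally show "(\<lambda>n. w (Suc n) - w n) \<in> O(\<lambda>n. 1 / real n - 1 / real (Suc n))" .
  show "\<forall>\<^sub>F n in sequentially. 1 / real (Suc n) \<le> 1 / real n"
    by (intro eventually_sequentiallyI[of 1]) (auto intro!: divide_left_mono)
qed real_asymp

section \<open>Meixner coefficients\<close>

text \<open>
  At \<open>x = \<mu>\<close> this says that the Meixner weights have total mass \<open>1\<close> after multiplication by
  \<open>(1 - \<mu>) powr \<gamma>\<close>, so \<open>meixner_K\<close> tends to \<open>1\<close>.
\<close>

lemma negative_binomial_series:
  fixes \<gamma> x :: real
  assumes "\<bar>x\<bar> < 1"
  shows "(\<lambda>n. pochhammer \<gamma> n / fact n * x ^ n) sums (1 - x) powr (- \<gamma>)"
proof -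
  have "(- \<gamma> gchoose n) * (- x) ^ n = pochhammer \<gamma> n / fact n * x ^ n" for n
    using power_mult_distrib[of "-1" "- x" n]
    by (simp add: gbinomial_pochhammer)
  with gen_binomial_real[of "- x" "- \<gamma>"] assms show ?thesis by simp
qed

lemma meixner_K_pred:
  assumes "n \<ge> 1"
  shows "meixner_K \<gamma> \<mu> (n - 1) = (1 - \<mu>) powr \<gamma> * (\<Sum>m<n. pochhammer \<gamma> m / fact m * \<mu> ^ m)"
proof -
  have "{0..n - 1} = {..<n}" using assms by auto
  then show ?thesis by (simp add: meixner_K_def)
qed

lemma meixner_K_nonneg: "\<gamma> > 0 \<Longrightarrow> \<mu> > 0 \<Longrightarrow> meixner_K \<gamma> \<mu> n \<ge> 0"
  unfolding meixner_K_def
  by (intro mult_nonneg_nonneg sum_nonneg divide_nonneg_nonneg pochhammer_nonneg zero_le_power) simp_all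

text \<open>
  The binomial series has radius of convergence \<open>1 > \<mu>\<close>, so it can be compared with its value at the
  midpoint of \<open>\<mu>\<close> and \<open>1\<close>. The same pair \<open>q\<close>, \<open>S\<close> controls the terms, needed for the decay of the
  coefficients, and the tails, needed for the replacement of the kernel by its limit.
\<close>

lemma meixner_series_geometric:
  fixes \<gamma> \<mu> :: real
  assumes \<gamma>: "\<gamma> > 0" and \<mu>: "0 < \<mu>" "\<mu> < 1"
  obtains q S where "0 < q" "q < 1"
    "\<And>n. pochhammer \<gamma> n / fact n * \<mu> ^ n \<le> S * q ^ n"
    "\<And>n. n \<ge> 1 \<Longrightarrow> 0 \<le> 1 - meixner_K \<gamma> \<mu> (n - 1)"
    "\<And>n. n \<ge> 1 \<Longrightarrow> 1 - meixner_K \<gamma> \<mu> (n - 1) \<le> S * q ^ n"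
proof
  define c where "c = (\<lambda>n. pochhammer \<gamma> n / fact n)"
  define y where "y = (1 + \<mu>) / 2"
  define S where "S = (\<Sum>n. c n * y ^ n)"
  have c: "c n \<ge> 0" for n
    using \<gamma> by (simp add: c_def pochhammer_nonneg)
  have y: "0 < y" "y < 1" "\<mu> < y"
    using \<mu> by (auto simp: y_def)
  have sm: "summable (\<lambda>n. c n * y ^ n)"
    using negative_binomial_series[of y \<gamma>] y by (auto simp: c_def sums_iff)
  note tail = nonneg_powser_tail_le[OF c sm less_imp_le[OF \<mu>(1)] y(3), folded S_def]
  show "0 < \<mu> / y" "\<mu> / y < 1"
    using y \<mu> by auto
  show "pochhammer \<gamma> n / fact n * \<mu> ^ n \<le> S * (\<mu> / y) ^ n" for n
    using tail(3)[of n] by (simp add: c_def mult_ac)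
  fix n :: nat assume n: "n \<ge> 1"
  have sum: "(\<Sum>n. c n * \<mu> ^ n) = (1 - \<mu>) powr (- \<gamma>)"
    using negative_binomial_series[of \<mu> \<gamma>] \<mu> by (simp add: c_def sums_iff)
  have "(1 - \<mu>) powr \<gamma> * (1 - \<mu>) powr (- \<gamma>) = 1"
    using \<mu> powr_add[of "1 - \<mu>" \<gamma> "- \<gamma>"] by simp
  then have "1 - (1 - \<mu>) powr \<gamma> * (\<Sum>m<n. c m * \<mu> ^ m)
      = (1 - \<mu>) powr \<gamma> * ((1 - \<mu>) powr (- \<gamma>) - (\<Sum>m<n. c m * \<mu> ^ m))"
    by (simp only: right_diff_distrib)
  also have "(1 - \<mu>) powr (- \<gamma>) - (\<Sum>m<n. c m * \<mu> ^ m) = (\<Sum>m. c (m + n) * \<mu> ^ (m + n))"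
    using suminf_split_initial_segment[OF tail(1), of n] sum by simp
  finally have eq: "1 - meixner_K \<gamma> \<mu> (n - 1) = (1 - \<mu>) powr \<gamma> * (\<Sum>m. c (m + n) * \<mu> ^ (m + n))"
    unfolding meixner_K_pred[OF n] c_def .
  have smn: "summable (\<lambda>m. c (m + n) * \<mu> ^ (m + n))"
    using tail(1) summable_iff_shift[of "\<lambda>m. c m * \<mu> ^ m" n] by blast
  have nn: "0 \<le> (\<Sum>m. c (m + n) * \<mu> ^ (m + n))"
    using c \<mu> by (intro suminf_nonneg smn) auto
  then show "0 \<le> 1 - meixner_K \<gamma> \<mu> (n - 1)"
    unfolding eq by simp
  have "(1 - \<mu>) powr \<gamma> \<le> 1"
    using \<gamma> \<mu> by (intro powr_le1) auto
  then have "1 - meixner_K \<gamma> \<mu> (n - 1) \<le> (\<Sum>m. c (m + n) * \<mu> ^ (m + n))"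
    unfolding eq using nn by (simp add: mult_left_le_one_le)
  also have "\<dots> \<le> S * (\<mu> / y) ^ n"
    using tail(2)[of n] by (simp add: mult_ac)
  finally show "1 - meixner_K \<gamma> \<mu> (n - 1) \<le> S * (\<mu> / y) ^ n" .
qed

text \<open>
  Two relative errors multiply: \<open>w\<close> from replacing \<open>pochhammer \<gamma> n / n!\<close> by its leading asymptotics,
  with \<open>w - 1 = O(1 / n)\<close>, and \<open>1 + \<delta>\<close> from replacing the kernel by its limit \<open>1\<close>, where \<open>\<delta>\<close> is
  geometrically small.
\<close>

lemma meixner_B_asymp:
  fixes A \<gamma> \<mu> :: real
  assumes A: "A > 0" and \<gamma>: "\<gamma> > 0" and \<mu>: "0 < \<mu>" "\<mu> < 1"
  shows "\<exists>\<epsilon> :: nat \<Rightarrow> real. \<epsilon> \<in> O(\<lambda>n. 1 / real n) \<and>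
           (\<forall>n\<ge>1. meixner_B A \<gamma> \<mu> n =
              A * (1 - \<mu>) powr (\<gamma> - 1) / ((1 + A) * Gamma \<gamma>)
                * \<mu> ^ n * real n powr (\<gamma> - 1) * (1 + \<epsilon> n))"
proof -
  obtain q S where q: "0 < q" "q < 1"
    and K1: "\<And>n. n \<ge> 1 \<Longrightarrow> 0 \<le> 1 - meixner_K \<gamma> \<mu> (n - 1)"
    and K2: "\<And>n. n \<ge> 1 \<Longrightarrow> 1 - meixner_K \<gamma> \<mu> (n - 1) \<le> S * q ^ n"
    using meixner_series_geometric[OF \<gamma> \<mu>] by metis
  define w where "w = (\<lambda>n. Gamma \<gamma> * pochhammer \<gamma> n / (fact n * real n powr (\<gamma> - 1)))"
  define \<delta> where "\<delta> = (\<lambda>n. let k = meixner_K \<gamma> \<mu> (n - 1) in A * (1 - k) / (1 + A * k))"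
  note K0 = meixner_K_nonneg[OF \<gamma> \<mu>(1)]
  have "\<bar>\<delta> n\<bar> \<le> A * S * \<bar>q ^ n\<bar>" if "n \<ge> 1" for n
  proof -
    have "\<bar>\<delta> n\<bar> \<le> A * (1 - meixner_K \<gamma> \<mu> (n - 1))"
      using mass_denominator_error(2)[OF A K0[of "n - 1"], of 1] K1[OF that]
      by (simp add: \<delta>_def Let_def)
    also have "\<dots> \<le> A * (S * q ^ n)"
      using K2[OF that] A by (intro mult_left_mono) auto
    finally show ?thesis using q by simp
  qed
  then have "\<delta> \<in> O(\<lambda>n. q ^ n)"
    by (intro bigoI[of _ "A * S"] eventually_sequentiallyI[of 1]) auto
  also have "(\<lambda>n. q ^ n) \<in> O(\<lambda>n. 1 / real n)"
    using q by real_asymp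
  finally have \<delta>: "\<delta> \<in> O(\<lambda>n. 1 / real n)" .
  have w: "(\<lambda>n. w n - 1) \<in> O(\<lambda>n. 1 / real n)"
    unfolding w_def by (rule pochhammer_over_fact_asymp[OF \<gamma>])
  have "(\<lambda>n. 1 / real n) \<in> O(\<lambda>_. 1)"
    by real_asymp
  with \<delta> have "\<delta> \<in> O(\<lambda>_. 1)"
    by (rule landau_o.big_trans)
  \<comment> \<open>The total error \<open>w * (1 + \<delta>) - 1\<close> expands to \<open>(w - 1) + \<delta> + (w - 1) * \<delta>\<close>.\<close>
  with w have "(\<lambda>n. (w n - 1) * \<delta> n) \<in> O(\<lambda>n. 1 / real n * 1)"
    by (rule landau_o.big.mult)
  with w \<delta> have "(\<lambda>n. (w n - 1) + \<delta> n + (w n - 1) * \<delta> n) \<in> O(\<lambda>n. 1 / real n)"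
    by (intro sum_in_bigo(1)) (simp_all only: mult_1_right)
  moreover have "meixner_B A \<gamma> \<mu> n = A * (1 - \<mu>) powr (\<gamma> - 1) / ((1 + A) * Gamma \<gamma>)
                * \<mu> ^ n * real n powr (\<gamma> - 1) * (1 + ((w n - 1) + \<delta> n + (w n - 1) * \<delta> n))"
    if n: "n \<ge> 1" for n
  proof -
    have "meixner_B A \<gamma> \<mu> n = A * (1 - \<mu>) powr (\<gamma> - 1) * \<mu> ^ n * (pochhammer \<gamma> n / fact n)
        * (1 / (1 + A * meixner_K \<gamma> \<mu> (n - 1)))"
      by (simp add: meixner_B_def mult_ac)
    also have "1 / (1 + A * meixner_K \<gamma> \<mu> (n - 1)) = 1 / (1 + A) * (1 + \<delta> n)"
      using mass_denominator_error(1)[OF A K0[of "n - 1"], of 1] K1[OF n] by (simp add: \<delta>_def Let_def)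
    also have "pochhammer \<gamma> n / fact n = 1 / Gamma \<gamma> * real n powr (\<gamma> - 1) * w n"
      using n Gamma_real_pos[OF \<gamma>] by (simp add: w_def)
    also have "A * (1 - \<mu>) powr (\<gamma> - 1) * \<mu> ^ n * (1 / Gamma \<gamma> * real n powr (\<gamma> - 1) * w n)
          * (1 / (1 + A) * (1 + \<delta> n))
        = A * (1 - \<mu>) powr (\<gamma> - 1) / ((1 + A) * Gamma \<gamma>)
          * \<mu> ^ n * real n powr (\<gamma> - 1) * (w n * (1 + \<delta> n))"
      by (simp add: mult_ac)
    also have "w n * (1 + \<delta> n) = 1 + ((w n - 1) + \<delta> n + (w n - 1) * \<delta> n)"
      by (simp add: algebra_simps)
    finally show ?thesis .
  qed
  ultimately show ?thesis by blast
qed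

lemma meixner_B_geometric:
  fixes A \<gamma> \<mu> :: real
  assumes A: "A > 0" and \<gamma>: "\<gamma> > 0" and \<mu>: "0 < \<mu>" "\<mu> < 1"
  obtains q where "0 < q" "q < 1" "meixner_B A \<gamma> \<mu> \<in> O(\<lambda>n. q ^ n)"
proof -
  obtain q S where q: "0 < q" "q < 1"
    and le: "\<And>n. pochhammer \<gamma> n / fact n * \<mu> ^ n \<le> S * q ^ n"
    using meixner_series_geometric[OF \<gamma> \<mu>] by metis
  define C where "C = A * (1 - \<mu>) powr (\<gamma> - 1)"
  have C: "C \<ge> 0" using A by (simp add: C_def)
  have "norm (meixner_B A \<gamma> \<mu> n) \<le> C * S * norm (q ^ n)" for n
  proof -
    define t where "t = pochhammer \<gamma> n / fact n * \<mu> ^ n"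
    have t: "t \<ge> 0" using \<gamma> \<mu> by (simp add: t_def pochhammer_nonneg)
    have K: "meixner_K \<gamma> \<mu> (n - 1) \<ge> 0" by (rule meixner_K_nonneg[OF \<gamma> \<mu>(1)])
    have "meixner_B A \<gamma> \<mu> n = C * t / (1 + A * meixner_K \<gamma> \<mu> (n - 1))"
      by (simp add: meixner_B_def C_def t_def mult_ac)
    then have "norm (meixner_B A \<gamma> \<mu> n) = C * t / (1 + A * meixner_K \<gamma> \<mu> (n - 1))"
      using A C t K by simp
    also have "\<dots> \<le> C * t / 1"
      using A C t K by (intro divide_left_mono) (auto intro: add_pos_nonneg)
    also have "\<dots> \<le> C * (S * q ^ n)"
      using mult_left_mono[OF le[of n] C] by (simp add: t_def)
    finally show ?thesis using q by (simp add: mult_ac)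
  qed
  then have "meixner_B A \<gamma> \<mu> \<in> O(\<lambda>n. q ^ n)"
    by (intro bigoI[of _ "C * S"] always_eventually allI)
  with q that show thesis by blast
qed

section \<open>Asymptotics of both coefficients\<close>

theorem lemma2p6:
  fixes A :: real
  assumes "A > 0"
  shows
    "(\<forall>\<mu>::real. \<mu> > 0 \<longrightarrow>
        (\<exists>\<epsilon> :: nat \<Rightarrow> real. \<epsilon> \<in> O(\<lambda>n. \<mu> ^ n / fact n) \<and>
           (\<forall>n\<ge>1. charlier_D A \<mu> n =
              A / (1 + A * exp \<mu>) * (\<mu> ^ n / fact n) * (1 + \<epsilon> n))) \<and>
        (\<forall>s::real. s \<ge> 0 \<longrightarrow> (\<lambda>n. real n powr s * charlier_D A \<mu> n) \<longlonglongrightarrow> 0) \<and>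
        charlier_D A \<mu> \<longlonglongrightarrow> 0 \<and>
        (\<lambda>n. real n * charlier_D A \<mu> n) \<longlonglongrightarrow> 0) \<and>
     (\<forall>(\<gamma>::real) (\<mu>::real). \<gamma> > 0 \<and> 0 < \<mu> \<and> \<mu> < 1 \<longrightarrow>
        (\<exists>\<epsilon> :: nat \<Rightarrow> real. \<epsilon> \<in> O(\<lambda>n. 1 / real n) \<and>
           (\<forall>n\<ge>1. meixner_B A \<gamma> \<mu> n =
              A * (1 - \<mu>) powr (\<gamma> - 1) / ((1 + A) * Gamma \<gamma>)
                * \<mu> ^ n * real n powr (\<gamma> - 1) * (1 + \<epsilon> n))) \<and>
        (\<forall>s::real. s \<ge> 0 \<longrightarrow> (\<lambda>n. real n powr s * meixner_B A \<gamma> \<mu> n) \<longlonglongrightarrow> 0) \<and>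
        meixner_B A \<gamma> \<mu> \<longlonglongrightarrow> 0 \<and>
        (\<lambda>n. real n * meixner_B A \<gamma> \<mu> n) \<longlonglongrightarrow> 0)"
proof (intro conjI allI impI)
  fix \<mu> :: real assume \<mu>: "\<mu> > 0"
  show "\<exists>\<epsilon> :: nat \<Rightarrow> real. \<epsilon> \<in> O(\<lambda>n. \<mu> ^ n / fact n) \<and>
           (\<forall>n\<ge>1. charlier_D A \<mu> n =
              A / (1 + A * exp \<mu>) * (\<mu> ^ n / fact n) * (1 + \<epsilon> n))"
    by (rule charlier_D_asymp[OF assms \<mu>])
  note decay = geometric_imp_rapid_decay[OF charlier_D_geometric[OF assms \<mu>]]
  show "(\<lambda>n. real n powr s * charlier_D A \<mu> n) \<longlonglongrightarrow> 0" for s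
    by (rule decay) auto
  show "charlier_D A \<mu> \<longlonglongrightarrow> 0" "(\<lambda>n. real n * charlier_D A \<mu> n) \<longlonglongrightarrow> 0"
    by (rule decay; simp)+
next
  fix \<gamma> \<mu> :: real assume *: "\<gamma> > 0 \<and> 0 < \<mu> \<and> \<mu> < 1"
  then have \<gamma>: "\<gamma> > 0" and \<mu>: "0 < \<mu>" "\<mu> < 1" by auto
  show "\<exists>\<epsilon> :: nat \<Rightarrow> real. \<epsilon> \<in> O(\<lambda>n. 1 / real n) \<and>
           (\<forall>n\<ge>1. meixner_B A \<gamma> \<mu> n =
              A * (1 - \<mu>) powr (\<gamma> - 1) / ((1 + A) * Gamma \<gamma>)
                * \<mu> ^ n * real n powr (\<gamma> - 1) * (1 + \<epsilon> n))"
    by (rule meixner_B_asymp[OF assms \<gamma> \<mu>])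
  obtain q where q: "0 < q" "q < 1" and B: "meixner_B A \<gamma> \<mu> \<in> O(\<lambda>n. q ^ n)"
    using meixner_B_geometric[OF assms \<gamma> \<mu>] .
  note decay = geometric_imp_rapid_decay[OF B q]
  show "(\<lambda>n. real n powr s * meixner_B A \<gamma> \<mu> n) \<longlonglongrightarrow> 0" for s
    by (rule decay)
  show "meixner_B A \<gamma> \<mu> \<longlonglongrightarrow> 0" "(\<lambda>n. real n * meixner_B A \<gamma> \<mu> n) \<longlonglongrightarrow> 0"
    by (rule decay)+
qed

end
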